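(* Let $\mathcal{F}$ be a spacelike foliation by hypersurfaces on the de Sitter space $\mathbb{S}^{n+1}_1$, with unit timelike normal field $N$, such that $\|\nabla_NN\|\in\mathcal{L}^1(\mathcal{F})$. Then it is not possible that all leaves of $\mathcal{F}$ are totally geodesic and at least one leaf is complete.
   Context: Let $\mathbb{R}^{n+2}_1$ be $\mathbb{R}^{n+2}$ with the Lorentz metric $g_{-1}(v,w)=\sum_{i=1}^{n+1}v_iw_i-v_{n+2}w_{n+2}$. The de Sitter space is the hyperquadric $\mathbb{S}^{n+1}_1=\{x\in\mathbb{R}^{n+2}_1: g_{-1}(x,x)=c\}$, $c>0$, with the induced Lorentz metric. A spacelike foliation by hypersurfaces is a codimension-one foliation such that the induced metric on each leaf is Riemannian; the unit timelike vector field $N$ normal to the leaves is defined on the whole manifold. $\nabla$ is the Levi-Civita connection of $\mathbb{S}^{n+1}_1$. A leaf is complete if it is complete for its induced Riemannian metric. For a vector field $X$, $\|X\|\in\mathcal{L}^1(\mathcal{F})$ means that for each leaf $L$ of $\mathcal{F}$ the function $\|X^{\top}\|$ is Lebesgue integrable on the Riemannian manifold $L$, where $X^\top$ is the tangent projection of $X$ on $L$. *)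

theory Defs
  imports "HOL-Analysis.Analysis"
begin

section \<open>Smoothness and tangent vectors\<close>

text \<open>The class \<open>C^k\<close> on an open set, by continuity of all iterated directional derivatives.\<close>

fun Ck_on :: "nat \<Rightarrow> 'a::real_normed_vector set \<Rightarrow> ('a \<Rightarrow> 'b::real_normed_vector) \<Rightarrow> bool" where
  "Ck_on 0 U f \<longleftrightarrow> continuous_on U f"
| "Ck_on (Suc k) U f \<longleftrightarrow>
     (\<forall>x\<in>U. f differentiable (at x)) \<and>
     (\<forall>v. Ck_on k U (\<lambda>x. frechet_derivative f (at x) v))"

text \<open>Smoothness on an arbitrary set means local extendability to smooth maps on open sets
  of the ambient space. For open sets and for embedded submanifolds this is the usual notion.\<close>

definition smooth_on :: "'a::real_normed_vector set \<Rightarrow> ('a \<Rightarrow> 'b::real_normed_vector) \<Rightarrow> bool" where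
  "smooth_on S f \<longleftrightarrow>
     (\<forall>p\<in>S. \<exists>U h. open U \<and> p \<in> U \<and> (\<forall>k. Ck_on k U h) \<and> (\<forall>x\<in>S \<inter> U. h x = f x))"

text \<open>Velocity vectors of smooth curves in \<open>S\<close>; used both for embedded
  submanifolds and for leaves of foliations. A curve with values in a leaf is automatically
  continuous (and smooth) for the leaf topology, because locally it stays in one plaque
  (see \<open>foliation_on\<close> below).\<close>

definition tangent_space :: "'a::real_normed_vector set \<Rightarrow> 'a \<Rightarrow> 'a set" where
  "tangent_space S p =
     {v. \<exists>\<gamma> e. 0 < e \<and> smooth_on {-e<..<e} \<gamma> \<and> \<gamma> ` {-e<..<e} \<subseteq> S \<and> \<gamma> 0 = p \<and>
           (\<gamma> has_vector_derivative v) (at (0::real))}"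

definition vector_fields :: "'a::real_normed_vector set \<Rightarrow> ('a \<Rightarrow> 'a) set" where
  "vector_fields M = {X. smooth_on M X \<and> (\<forall>p\<in>M. X p \<in> tangent_space M p)}"

text \<open>The derivative \<open>X f\<close> of a function along a vector field. A derivative of \<open>f\<close> at \<open>p\<close>
  within \<open>M\<close> is not unique as a linear map on the ambient space, but its values on
  \<open>tangent_space M p\<close> are, by the chain rule along curves in \<open>M\<close>.\<close>

definition deriv_along ::
    "'a::real_normed_vector set \<Rightarrow> ('a \<Rightarrow> 'a) \<Rightarrow> ('a \<Rightarrow> real) \<Rightarrow> 'a \<Rightarrow> real" where
  "deriv_along M X f p = frechet_derivative f (at p within M) (X p)"

text \<open>Injective smooth immersions of an open set into \<open>S\<close>. They are used only
  when the dimension of the domain equals that of \<open>S\<close> (an embedded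
  submanifold or a leaf); by the inverse function theorem such a map is then a diffeomorphism onto
  an open subset of \<open>S\<close>, so it is the inverse of a chart.\<close>

definition regular_param ::
    "'a::real_normed_vector set \<Rightarrow> 'b::real_normed_vector set \<Rightarrow> ('b \<Rightarrow> 'a) \<Rightarrow> bool" where
  "regular_param S V \<sigma> \<longleftrightarrow>
     open V \<and> smooth_on V \<sigma> \<and> inj_on \<sigma> V \<and> \<sigma> ` V \<subseteq> S \<and>
     (\<forall>x\<in>V. inj (frechet_derivative \<sigma> (at x)))"

section \<open>Lorentz space and de Sitter space\<close>

text \<open>With \<open>n = CARD('n)\<close>, the space of dimension \<open>n + 2\<close>; the last coordinate is timelike, and the
  first \<open>n + 1\<close> coordinates are split as \<open>n + 1\<close> so that the dimension \<open>n\<close> of the leaves is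
  available as the type \<open>real ^ 'n\<close>.\<close>

type_synonym 'n lorentz_space = "((real ^ 'n) \<times> real) \<times> real"

definition lorentz :: "'n::finite lorentz_space \<Rightarrow> 'n lorentz_space \<Rightarrow> real" where
  "lorentz v w = (\<Sum>i\<in>UNIV. fst (fst v) $ i * fst (fst w) $ i) + snd (fst v) * snd (fst w)
                 - snd v * snd w"

definition lorentz_norm :: "'n::finite lorentz_space \<Rightarrow> real" where
  "lorentz_norm v = sqrt \<bar>lorentz v v\<bar>"

definition de_sitter :: "real \<Rightarrow> 'n::finite lorentz_space set" where
  "de_sitter c = {x. lorentz x x = c}"

text \<open>\<open>D\<close> is the Levi-Civita connection of the metric induced on \<open>M\<close>: an affine connection on the
  smooth vector fields which is metric and torsion-free. The bracket is expressed through its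
  action \<open>[X,Y] f = X (Y f) - Y (X f)\<close> on functions. Only values at
  points of \<open>M\<close> are relevant.\<close>

definition levi_civita ::
    "'n::finite lorentz_space set \<Rightarrow>
     (('n lorentz_space \<Rightarrow> 'n lorentz_space) \<Rightarrow> ('n lorentz_space \<Rightarrow> 'n lorentz_space) \<Rightarrow>
       'n lorentz_space \<Rightarrow> 'n lorentz_space) \<Rightarrow> bool" where
  "levi_civita M D \<longleftrightarrow>
     (\<forall>X\<in>vector_fields M. \<forall>Y\<in>vector_fields M. D X Y \<in> vector_fields M) \<and>
     (\<forall>X\<in>vector_fields M. \<forall>X'\<in>vector_fields M. \<forall>Y\<in>vector_fields M. \<forall>p\<in>M.
        D (\<lambda>x. X x + X' x) Y p = D X Y p + D X' Y p) \<and>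
     (\<forall>X\<in>vector_fields M. \<forall>Y\<in>vector_fields M. \<forall>f. smooth_on M f \<longrightarrow>
        (\<forall>p\<in>M. D (\<lambda>x. f x *\<^sub>R X x) Y p = f p *\<^sub>R D X Y p)) \<and>
     (\<forall>X\<in>vector_fields M. \<forall>Y\<in>vector_fields M. \<forall>Y'\<in>vector_fields M. \<forall>p\<in>M.
        D X (\<lambda>x. Y x + Y' x) p = D X Y p + D X Y' p) \<and>
     (\<forall>X\<in>vector_fields M. \<forall>Y\<in>vector_fields M. \<forall>f. smooth_on M f \<longrightarrow>
        (\<forall>p\<in>M. D X (\<lambda>x. f x *\<^sub>R Y x) p = deriv_along M X f p *\<^sub>R Y p + f p *\<^sub>R D X Y p)) \<and>
     (\<forall>X\<in>vector_fields M. \<forall>Y\<in>vector_fields M. \<forall>Z\<in>vector_fields M. \<forall>p\<in>M.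
        deriv_along M X (\<lambda>x. lorentz (Y x) (Z x)) p =
          lorentz (D X Y p) (Z p) + lorentz (Y p) (D X Z p)) \<and>
     (\<forall>X\<in>vector_fields M. \<forall>Y\<in>vector_fields M. \<forall>f. smooth_on M f \<longrightarrow>
        (\<forall>p\<in>M. deriv_along M (\<lambda>x. D X Y x - D Y X x) f p =
           deriv_along M X (deriv_along M Y f) p - deriv_along M Y (deriv_along M X f) p))"

section \<open>Foliations by spacelike hypersurfaces\<close>

text \<open>A smooth foliation of \<open>M\<close> of codimension one, given by the set \<open>F\<close> of its leaves: around each
  point there are coordinates \<open>(x, y)\<close> in a product \<open>V \<times> J\<close> such that the components of
  the intersection of any leaf with the coordinate domain are plaques \<open>y = const\<close>.
  Leaves are connected in the leaf topology. This is expressed by path connectedness in \<open>M\<close>,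
  which amounts to the same, as paths in \<open>L\<close> locally stay in one plaque;
  connectedness in the subspace topology would be too weak, since unions
  of leaves that are dense in \<open>M\<close> are connected in \<open>M\<close>.\<close>

definition foliation_on :: "'n::finite lorentz_space set \<Rightarrow> 'n lorentz_space set set \<Rightarrow> bool" where
  "foliation_on M F \<longleftrightarrow>
     partition_on M F \<and>
     (\<forall>L\<in>F. path_connected L) \<and>
     (\<forall>p\<in>M. \<exists>(V :: (real ^ 'n) set) (J :: real set) \<sigma>.
        open V \<and> connected V \<and> open J \<and> connected J \<and>
        regular_param M (V \<times> J) \<sigma> \<and> p \<in> \<sigma> ` (V \<times> J) \<and>
        (\<forall>L\<in>F. components (L \<inter> \<sigma> ` (V \<times> J)) \<subseteq> {\<sigma> ` (V \<times> {y}) | y. y \<in> J}))"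

definition spacelike_foliation_on ::
    "'n::finite lorentz_space set \<Rightarrow> 'n lorentz_space set set \<Rightarrow> bool" where
  "spacelike_foliation_on M F \<longleftrightarrow>
     foliation_on M F \<and>
     (\<forall>L\<in>F. \<forall>p\<in>L. \<forall>v\<in>tangent_space L p. v \<noteq> 0 \<longrightarrow> 0 < lorentz v v)"

definition unit_timelike_normal_field ::
    "'n::finite lorentz_space set \<Rightarrow> 'n lorentz_space set set \<Rightarrow>
     ('n lorentz_space \<Rightarrow> 'n lorentz_space) \<Rightarrow> bool" where
  "unit_timelike_normal_field M F N \<longleftrightarrow>
     N \<in> vector_fields M \<and>
     (\<forall>p\<in>M. lorentz (N p) (N p) = -1) \<and>
     (\<forall>L\<in>F. \<forall>p\<in>L. \<forall>v\<in>tangent_space L p. lorentz (N p) v = 0)"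

text \<open>Components of a tangent vector \<open>v\<close> along a unit timelike normal vector \<open>\<nu>\<close> of a leaf and
  tangent to the leaf; the sign comes from \<open>lorentz \<nu> \<nu> = -1\<close>.\<close>

definition normal_part :: "'n::finite lorentz_space \<Rightarrow> 'n lorentz_space \<Rightarrow> 'n lorentz_space" where
  "normal_part \<nu> v = - (lorentz v \<nu> *\<^sub>R \<nu>)"

definition tangent_part :: "'n::finite lorentz_space \<Rightarrow> 'n lorentz_space \<Rightarrow> 'n lorentz_space" where
  "tangent_part \<nu> v = v - normal_part \<nu> v"

text \<open>The second fundamental form \<open>II (X, Y)\<close>, the normal component of \<open>D X Y\<close>, vanishes for all
  \<open>X\<close> and \<open>Y\<close> tangent to the leaf. Every tangent vector of a leaf of a foliation extends to a
  smooth field on \<open>M\<close> tangent to all leaves, so considering fields on all of \<open>M\<close>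
  loses nothing.\<close>

definition totally_geodesic_leaf ::
    "'n::finite lorentz_space set \<Rightarrow>
     (('n lorentz_space \<Rightarrow> 'n lorentz_space) \<Rightarrow> ('n lorentz_space \<Rightarrow> 'n lorentz_space) \<Rightarrow>
       'n lorentz_space \<Rightarrow> 'n lorentz_space) \<Rightarrow>
     ('n lorentz_space \<Rightarrow> 'n lorentz_space) \<Rightarrow> 'n lorentz_space set \<Rightarrow> bool" where
  "totally_geodesic_leaf M D N L \<longleftrightarrow>
     (\<forall>X\<in>vector_fields M. \<forall>Y\<in>vector_fields M.
        (\<forall>p\<in>L. X p \<in> tangent_space L p \<and> Y p \<in> tangent_space L p) \<longrightarrow>
        (\<forall>p\<in>L. normal_part (N p) (D X Y p) = 0))"

section \<open>Completeness and integrability on a leaf\<close>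

definition arc_length :: "(real \<Rightarrow> 'n::finite lorentz_space) \<Rightarrow> ennreal" where
  "arc_length \<gamma> =
     (\<integral>\<^sup>+t\<in>{0..1}. ennreal (lorentz_norm (vector_derivative \<gamma> (at t))) \<partial>lborel)"

text \<open>The distance of the induced Riemannian metric of the leaf \<open>L\<close>. It is finite for points of \<open>L\<close>,
  since \<open>L\<close> is connected.\<close>

definition leaf_dist ::
    "'n::finite lorentz_space set \<Rightarrow> 'n lorentz_space \<Rightarrow> 'n lorentz_space \<Rightarrow> real" where
  "leaf_dist L p q =
     enn2real (INF \<gamma>\<in>{\<gamma>. valid_path \<gamma> \<and> path_image \<gamma> \<subseteq> L \<and> pathstart \<gamma> = p \<and> pathfinish \<gamma> = q}.
                 arc_length \<gamma>)"

definition complete_leaf :: "'n::finite lorentz_space set \<Rightarrow> bool" where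
  "complete_leaf L \<longleftrightarrow> Metric_space.mcomplete L (leaf_dist L)"

definition volume_density :: "(real ^ 'n \<Rightarrow> 'n::finite lorentz_space) \<Rightarrow> real ^ 'n \<Rightarrow> real" where
  "volume_density \<sigma> x =
     sqrt (det (\<chi> i j. lorentz (frechet_derivative \<sigma> (at x) (axis i 1))
                              (frechet_derivative \<sigma> (at x) (axis j 1)) :: real ^ 'n ^ 'n))"

text \<open>\<open>\<mu>\<close> is the Riemannian volume measure of the leaf \<open>L\<close>, on the Borel sets of the leaf topology.
  It exists and is unique because leaves are second countable.\<close>

definition leaf_volume :: "'n::finite lorentz_space set \<Rightarrow> 'n lorentz_space measure \<Rightarrow> bool" where
  "leaf_volume L \<mu> \<longleftrightarrow>
     space \<mu> = L \<and>
     sets \<mu> = sigma_sets L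
       {\<sigma> ` A | \<sigma> (V :: (real ^ 'n) set) A. regular_param L V \<sigma> \<and> A \<in> sets borel \<and> A \<subseteq> V} \<and>
     (\<forall>\<sigma> (V :: (real ^ 'n) set) A. regular_param L V \<sigma> \<and> A \<in> sets borel \<and> A \<subseteq> V \<longrightarrow>
        emeasure \<mu> (\<sigma> ` A) = (\<integral>\<^sup>+x\<in>A. ennreal (volume_density \<sigma> x) \<partial>lborel))"

text \<open>The condition that \<open>\<parallel>X\<parallel>\<close> belongs to \<open>L^1(F)\<close>.\<close>

definition leafwise_L1 ::
    "'n::finite lorentz_space set set \<Rightarrow> ('n lorentz_space \<Rightarrow> 'n lorentz_space) \<Rightarrow>
     ('n lorentz_space \<Rightarrow> 'n lorentz_space) \<Rightarrow> bool" where
  "leafwise_L1 F N X \<longleftrightarrow>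
     (\<forall>L\<in>F. \<exists>\<mu>. leaf_volume L \<mu> \<and> integrable \<mu> (\<lambda>p. lorentz_norm (tangent_part (N p) (X p))))"

end

theory Submission
  imports Defs
begin

text \<open>Suppose that all leaves are totally geodesic. The idea is that every leaf then fills a whole great
  sphere, the intersection of the hyperquadric with a spacelike hyperplane through the origin, and that two
  such spheres always intersect, while distinct leaves are disjoint. The argument is carried out
  for the normal field \<open>N\<close>, regarded as a map into the ambient vector space.

  The Levi-Civita connection is the tangential part of the ambient derivative
  (\<open>levi_civita_tangential_part\<close>), and the tangent space of the leaf through \<open>p\<close> consists of the vectors
  orthogonal to \<open>p\<close> and \<open>N p\<close> (\<open>horizontal_subset_tangent_space_leaf\<close>). Hence the vanishing of the second
  fundamental form says that \<open>N\<close> has zero ambient derivative in these directions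
  (\<open>normal_derivative_zero\<close>).

  Now fix a point \<open>q\<close> and a great circle through \<open>q\<close> orthogonal to \<open>N q\<close>. Along it the
  difference between \<open>N\<close> and \<open>N q\<close> solves a homogeneous linear differential equation, so it vanishes
  (\<open>normal_constant_on_great_circle\<close>). These great circles cover the great sphere orthogonal to \<open>N q\<close>
  (\<open>great_sphere_covered_by_great_circles\<close>), and \<open>N\<close> is constant there.

  As \<open>n\<close> is at least \<open>1\<close>, any two of these great spheres have a common point
  (\<open>exists_lorentz_orthogonal_to_two\<close>). At such a point \<open>N\<close> takes the values belonging to both
  spheres, so \<open>N\<close> has the same value \<open>\<nu>\<close> everywhere. But \<open>N\<close> is tangent to the hyperquadric, so
  all its points would be orthogonal to \<open>\<nu>\<close>, and they are not.\<close>

section \<open>Calculus of smooth maps\<close>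

lemma Ck_on_subset: "Ck_on k U f \<Longrightarrow> W \<subseteq> U \<Longrightarrow> Ck_on k W f"
  by (induction k arbitrary: f) (auto intro: continuous_on_subset)

text \<open>For \<open>k = 0\<close> this is differentiability implying continuity; higher orders reduce to it because
  both classes are defined by the same recursion on directional derivatives.\<close>

lemma Ck_on_Suc_imp: "Ck_on (Suc k) U f \<Longrightarrow> Ck_on k U f"
proof (induction k arbitrary: f)
  case 0
  then show ?case
    by (auto intro!: continuous_at_imp_continuous_on differentiable_imp_continuous_within)
next
  case (Suc k)
  show ?case
    using Suc.prems Suc.IH by simp
qed

lemma Ck_on_cong:
  assumes "open U" "\<And>x. x \<in> U \<Longrightarrow> f x = g x" "Ck_on k U f"
  shows "Ck_on k U g"
  using assms(2,3)
proof (induction k arbitrary: f g)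
  case 0
  then show ?case by (simp cong: continuous_on_cong)
next
  case (Suc k)
  have d: "(g has_derivative frechet_derivative f (at x)) (at x)" if "x \<in> U" for x
    using Suc.prems that assms(1)
    by (auto intro!: has_derivative_transform_within_open[of f _ x _ U g]
        simp: frechet_derivative_works[symmetric])
  show ?case
    unfolding Ck_on.simps
  proof (intro conjI ballI allI)
    show "g differentiable at x" if "x \<in> U" for x
      using d[OF that] by (auto simp: differentiable_def)
    show "Ck_on k U (\<lambda>x. frechet_derivative g (at x) v)" for v
    proof (rule Suc.IH)
      show "frechet_derivative f (at x) v = frechet_derivative g (at x) v" if "x \<in> U" for x
        using frechet_derivative_at[OF d[OF that]] by simp
      show "Ck_on k U (\<lambda>x. frechet_derivative f (at x) v)"
        using Suc.prems by simp
    qed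
  qed
qed

lemma Ck_on_has_derivative:
  assumes "Ck_on (Suc k) U f" "x \<in> U"
  shows "(f has_derivative frechet_derivative f (at x)) (at x)"
  using assms by (simp add: frechet_derivative_works[symmetric])

text \<open>Smoothness of order \<open>k + 1\<close> can be checked with any formula for the derivative.\<close>

lemma Ck_on_SucI:
  assumes "open U" "\<And>x. x \<in> U \<Longrightarrow> (f has_derivative f' x) (at x)"
    and "\<And>v. Ck_on k U (\<lambda>x. f' x v)"
  shows "Ck_on (Suc k) U f"
  unfolding Ck_on.simps
proof (intro conjI ballI allI)
  show "f differentiable at x" if "x \<in> U" for x
    using assms(2)[OF that] by (auto simp: differentiable_def)
  show "Ck_on k U (\<lambda>x. frechet_derivative f (at x) v)" for v
    by (rule Ck_on_cong[OF assms(1) _ assms(3)[of v]])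
      (use frechet_derivative_at[OF assms(2)] in simp)
qed

lemma Ck_on_const: "open U \<Longrightarrow> Ck_on k U (\<lambda>x. b)"
proof (induction k arbitrary: b)
  case (Suc k)
  show ?case by (rule Ck_on_SucI[where f' = "\<lambda>x v. 0"]) (use Suc in auto)
qed simp

lemma Ck_on_bounded_linear:
  assumes "open U" "bounded_linear f"
  shows "Ck_on k U f"
proof (cases k)
  case 0
  then show ?thesis using assms(2) by (simp add: linear_continuous_on)
next
  case (Suc j)
  show ?thesis
    unfolding Suc using assms
    by (intro Ck_on_SucI[where f' = "\<lambda>x. f"] Ck_on_const bounded_linear_imp_has_derivative)
qed

lemma Ck_on_add:
  assumes "open U" "Ck_on k U f" "Ck_on k U g"
  shows "Ck_on k U (\<lambda>x. f x + g x)"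
  using assms(2,3)
proof (induction k arbitrary: f g)
  case 0
  then show ?case by (simp add: continuous_on_add)
next
  case (Suc k)
  show ?case
  proof (rule Ck_on_SucI[OF assms(1)])
    show "((\<lambda>x. f x + g x) has_derivative
        (\<lambda>v. frechet_derivative f (at x) v + frechet_derivative g (at x) v)) (at x)"
      if "x \<in> U" for x
      by (intro has_derivative_add Ck_on_has_derivative[OF Suc.prems(1) that]
          Ck_on_has_derivative[OF Suc.prems(2) that])
    show "Ck_on k U (\<lambda>x. frechet_derivative f (at x) v + frechet_derivative g (at x) v)" for v
      using Suc.prems by (intro Suc.IH) auto
  qed
qed

text \<open>The product rule expresses the derivative through products of one factor with the derivative
  of the other. The undifferentiated factor is only known to be one order smoother than required,
  which is where the inclusion of \<open>C^(k+1)\<close> in \<open>C^k\<close> enters.\<close>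

lemma Ck_on_bilinear:
  assumes "open U" "bounded_bilinear B" "Ck_on k U f" "Ck_on k U g"
  shows "Ck_on k U (\<lambda>x. B (f x) (g x))"
  using assms(3,4)
proof (induction k arbitrary: f g)
  case 0
  then show ?case
    using bounded_bilinear.continuous_on[OF assms(2)] by auto
next
  case (Suc k)
  show ?case
  proof (rule Ck_on_SucI[OF assms(1)])
    show "((\<lambda>x. B (f x) (g x)) has_derivative
        (\<lambda>v. B (f x) (frechet_derivative g (at x) v) + B (frechet_derivative f (at x) v) (g x))) (at x)"
      if "x \<in> U" for x
      by (intro bounded_bilinear.FDERIV[OF assms(2)] Ck_on_has_derivative[OF Suc.prems(1) that]
          Ck_on_has_derivative[OF Suc.prems(2) that])
    show "Ck_on k U (\<lambda>x. B (f x) (frechet_derivative g (at x) v) + B (frechet_derivative f (at x) v) (g x))"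
      for v
      using Suc.prems Ck_on_Suc_imp[OF Suc.prems(1)] Ck_on_Suc_imp[OF Suc.prems(2)]
      by (intro Ck_on_add[OF assms(1)] Suc.IH) auto
  qed
qed

lemma Ck_on_compose_affine:
  assumes "open W" "bounded_linear A" "\<And>x. x \<in> W \<Longrightarrow> A x + b \<in> U" "Ck_on k U f"
  shows "Ck_on k W (\<lambda>x. f (A x + b))"
  using assms(4)
proof (induction k arbitrary: f)
  case 0
  have "continuous_on W (\<lambda>x. A x + b)"
    using assms(2) by (intro continuous_intros linear_continuous_on)
  then show ?case
    using 0 assms(3) by (auto intro: continuous_on_compose2)
next
  case (Suc k)
  show ?case
  proof (rule Ck_on_SucI[OF assms(1)])
    fix x assume x: "x \<in> W"
    have "((\<lambda>x. A x + b) has_derivative A) (at x)"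
      using bounded_linear_imp_has_derivative[OF assms(2), of "at x"]
      by (auto intro!: derivative_eq_intros)
    from has_derivative_compose[OF this Ck_on_has_derivative[OF Suc.prems assms(3)[OF x]]]
    show "((\<lambda>x. f (A x + b)) has_derivative (\<lambda>v. frechet_derivative f (at (A x + b)) (A v))) (at x)"
      .
  next
    show "Ck_on k W (\<lambda>x. frechet_derivative f (at (A x + b)) (A v))" for v
      using Suc.IH[of "\<lambda>y. frechet_derivative f (at y) (A v)"] Suc.prems by simp
  qed
qed

text \<open>Naming the local extensions keeps the quantifiers over \<open>k\<close> and \<open>x\<close> folded,
  so that extensions of two functions can be chosen and restricted together.\<close>

definition smooth_extension ::
    "'a::real_normed_vector set \<Rightarrow> ('a \<Rightarrow> 'b::real_normed_vector) \<Rightarrow> 'a \<Rightarrow> 'a set \<Rightarrow> ('a \<Rightarrow> 'b) \<Rightarrow> bool"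
  where "smooth_extension S f p U h \<longleftrightarrow>
    open U \<and> p \<in> U \<and> (\<forall>k. Ck_on k U h) \<and> (\<forall>x\<in>S \<inter> U. h x = f x)"

lemma smooth_on_iff_extension:
  "smooth_on S f \<longleftrightarrow> (\<forall>p\<in>S. \<exists>U h. smooth_extension S f p U h)"
  unfolding smooth_on_def smooth_extension_def ..

lemma smooth_on_bounded_linear: "bounded_linear f \<Longrightarrow> smooth_on S f"
  unfolding smooth_on_iff_extension
  by (intro ballI exI[of _ UNIV] exI[of _ f]) (simp add: smooth_extension_def Ck_on_bounded_linear)

lemma smooth_on_const: "smooth_on S (\<lambda>x. b)"
  unfolding smooth_on_iff_extension
  by (intro ballI exI[of _ UNIV] exI[of _ "\<lambda>x. b"]) (simp add: smooth_extension_def Ck_on_const)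

lemma smooth_on_bilinear:
  assumes "bounded_bilinear B" "smooth_on S f" "smooth_on S g"
  shows "smooth_on S (\<lambda>x. B (f x) (g x))"
  unfolding smooth_on_iff_extension
proof
  fix p assume "p \<in> S"
  then obtain U h U' h' where "smooth_extension S f p U h" "smooth_extension S g p U' h'"
    using assms(2,3) unfolding smooth_on_iff_extension by meson
  then have "smooth_extension S (\<lambda>x. B (f x) (g x)) p (U \<inter> U') (\<lambda>x. B (h x) (h' x))"
    unfolding smooth_extension_def
    using Ck_on_bilinear[OF _ assms(1), of "U \<inter> U'" _ h h'] Ck_on_subset[of _ U h "U \<inter> U'"]
      Ck_on_subset[of _ U' h' "U \<inter> U'"] by (simp add: open_Int)
  then show "\<exists>U h. smooth_extension S (\<lambda>x. B (f x) (g x)) p U h" by blast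
qed

lemma smooth_on_add:
  assumes "smooth_on S f" "smooth_on S g"
  shows "smooth_on S (\<lambda>x. f x + g x)"
  unfolding smooth_on_iff_extension
proof
  fix p assume "p \<in> S"
  then obtain U h U' h' where "smooth_extension S f p U h" "smooth_extension S g p U' h'"
    using assms unfolding smooth_on_iff_extension by meson
  then have "smooth_extension S (\<lambda>x. f x + g x) p (U \<inter> U') (\<lambda>x. h x + h' x)"
    unfolding smooth_extension_def
    using Ck_on_add[of "U \<inter> U'" _ h h'] Ck_on_subset[of _ U h "U \<inter> U'"]
      Ck_on_subset[of _ U' h' "U \<inter> U'"] by (simp add: open_Int)
  then show "\<exists>U h. smooth_extension S (\<lambda>x. f x + g x) p U h" by blast
qed

lemma smooth_on_compose_affine:
  assumes "smooth_on S f" "bounded_linear A" "\<And>x. x \<in> T \<Longrightarrow> A x + b \<in> S"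
  shows "smooth_on T (\<lambda>x. f (A x + b))"
  unfolding smooth_on_iff_extension
proof
  fix p assume p: "p \<in> T"
  then obtain U h where h: "smooth_extension S f (A p + b) U h"
    using assms(1,3) unfolding smooth_on_iff_extension by meson
  define W where "W = (\<lambda>x. A x + b) -` U"
  have "open W"
    unfolding W_def using h assms(2) unfolding smooth_extension_def
    by (intro open_vimage continuous_on_add continuous_on_const linear_continuous_on) simp_all
  moreover have "Ck_on k W (\<lambda>x. h (A x + b))" for k
    using h unfolding smooth_extension_def
    by (intro Ck_on_compose_affine[OF \<open>open W\<close> assms(2), of b U]) (simp_all add: W_def)
  ultimately have "smooth_extension T (\<lambda>x. f (A x + b)) p W (\<lambda>x. h (A x + b))"
    using h assms(3) unfolding smooth_extension_def by (simp add: W_def)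
  then show "\<exists>U h. smooth_extension T (\<lambda>x. f (A x + b)) p U h" by blast
qed

text \<open>A local smooth extension and the function agree on \<open>S\<close> near \<open>p\<close>, so the derivative of the
  extension is one of the derivatives of the function within \<open>S\<close>.\<close>

lemma smooth_on_differentiable:
  assumes "smooth_on S f" "p \<in> S"
  shows "f differentiable (at p within S)"
proof -
  obtain U h where "smooth_extension S f p U h"
    using assms unfolding smooth_on_iff_extension by meson
  then have h: "open U" "p \<in> U" "Ck_on (Suc 0) U h" "\<forall>x\<in>S \<inter> U. h x = f x"
    unfolding smooth_extension_def by blast+
  have d: "(h has_derivative frechet_derivative h (at p)) (at p within S)"
    by (rule has_derivative_at_withinI[OF Ck_on_has_derivative[OF h(3,2)]])
  obtain e where e: "0 < e" "ball p e \<subseteq> U"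
    using h(1,2) open_contains_ball by blast
  have "(f has_derivative frechet_derivative h (at p)) (at p within S)"
    by (rule has_derivative_transform_within[OF d e(1) assms(2)])
      (use e h(4) in \<open>auto simp: dist_commute subset_iff\<close>)
  then show ?thesis by (auto simp: differentiable_def)
qed

lemma smooth_on_continuous_on: "smooth_on S f \<Longrightarrow> continuous_on S f"
  by (simp add: continuous_on_eq_continuous_within differentiable_imp_continuous_within
      smooth_on_differentiable)

section \<open>Tangent vectors and directional derivatives\<close>

lemma has_vector_derivative_along:
  assumes "(f has_derivative A) (at (\<gamma> t) within M)" "(\<gamma> has_vector_derivative v) (at t within S)"
    and "\<gamma> ` S \<subseteq> M"
  shows "((\<lambda>t. f (\<gamma> t)) has_vector_derivative A v) (at t within S)"
  using vector_derivative_diff_chain_within[OF assms(2) has_derivative_subset[OF assms(1,3)]]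
  by (simp add: o_def)

text \<open>The chain rule along curves determines a derivative within \<open>M\<close> on tangent vectors of \<open>M\<close>,
  although not on the ambient space.\<close>

lemma derivative_unique_on_tangent_space:
  assumes "(f has_derivative A) (at p within M)" "(f has_derivative B) (at p within M)"
    and "v \<in> tangent_space M p"
  shows "A v = B v"
proof -
  obtain \<gamma> e where g: "0 < e" "\<gamma> ` {-e<..<e} \<subseteq> M" "\<gamma> 0 = p"
    "(\<gamma> has_vector_derivative v) (at (0::real))"
    using assms(3) unfolding tangent_space_def by blast
  have v: "(\<gamma> has_vector_derivative v) (at 0 within {-e<..<e})"
    using g(4) by (rule has_vector_derivative_at_within)
  have at: "at 0 within {-e<..<e} = at (0::real)"
    using g(1) by (intro at_within_open) auto
  show ?thesis
    using has_vector_derivative_along[OF _ v g(2), of f A] has_vector_derivative_along[OF _ v g(2), of f B]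
      assms(1,2) g(3) vector_derivative_unique_at unfolding at by metis
qed

lemma tangent_space_mono: "L \<subseteq> M \<Longrightarrow> tangent_space L p \<subseteq> tangent_space M p"
  unfolding tangent_space_def by blast

lemma frechet_derivative_on_tangent_space:
  assumes "(f has_derivative A) (at p within M)" "v \<in> tangent_space M p"
  shows "frechet_derivative f (at p within M) v = A v"
  using assms derivative_unique_on_tangent_space
  by (metis differentiable_def frechet_derivative_works)

section \<open>Lorentz geometry\<close>

lemma lorentz_eq: "lorentz v w = inner (fst v) (fst w) - snd v * snd w"
  by (simp add: lorentz_def inner_prod_def inner_vec_def)

lemma lorentz_eq_inner: "lorentz v w = inner v (fst w, - snd w)"
  by (simp add: lorentz_eq inner_prod_def)

lemma bounded_bilinear_lorentz:
  "bounded_bilinear (lorentz :: 'n::finite lorentz_space \<Rightarrow> 'n lorentz_space \<Rightarrow> real)"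
  unfolding bilinear_conv_bounded_bilinear[symmetric] bilinear_def
  by (auto intro!: linearI simp: lorentz_eq algebra_simps inner_add_left inner_add_right)

lemmas lorentz_simps =
  bounded_bilinear.add_left[OF bounded_bilinear_lorentz]
  bounded_bilinear.add_right[OF bounded_bilinear_lorentz]
  bounded_bilinear.diff_left[OF bounded_bilinear_lorentz]
  bounded_bilinear.diff_right[OF bounded_bilinear_lorentz]
  bounded_bilinear.scaleR_left[OF bounded_bilinear_lorentz]
  bounded_bilinear.scaleR_right[OF bounded_bilinear_lorentz]
  bounded_bilinear.minus_left[OF bounded_bilinear_lorentz]
  bounded_bilinear.minus_right[OF bounded_bilinear_lorentz]
  bounded_bilinear.zero_left[OF bounded_bilinear_lorentz]
  bounded_bilinear.zero_right[OF bounded_bilinear_lorentz]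

lemma lorentz_commute: "lorentz v w = lorentz w v"
  by (simp add: lorentz_eq inner_commute mult.commute)

lemma lorentz_nondegenerate:
  assumes "\<And>w. lorentz v w = 0"
  shows "v = 0"
proof -
  have "lorentz v (fst v, - snd v) = inner v v"
    by (simp add: lorentz_eq inner_prod_def)
  with assms show ?thesis by simp
qed

text \<open>Cauchy--Schwarz for the spatial parts: if \<open>v\<close> were not spacelike, its time component would bound
  its spatial part, whereas that of \<open>\<nu>\<close> is strictly shorter than its time component; this forces
  \<open>v = 0\<close>.\<close>

lemma lorentz_pos_on_timelike_complement:
  assumes \<nu>: "lorentz \<nu> \<nu> = -1" and "lorentz v \<nu> = 0" "v \<noteq> 0"
  shows "0 < lorentz v v"
proof (rule ccontr)
  assume "\<not> 0 < lorentz v v"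
  then have le: "inner (fst v) (fst v) \<le> (snd v)\<^sup>2"
    by (simp add: lorentz_eq power2_eq_square)
  have a: "inner (fst \<nu>) (fst \<nu>) = (snd \<nu>)\<^sup>2 - 1"
    using \<nu> by (simp add: lorentz_eq power2_eq_square)
  then have s1: "0 \<le> (snd \<nu>)\<^sup>2 - 1"
    by (metis inner_ge_zero)
  have "(snd v)\<^sup>2 * (snd \<nu>)\<^sup>2 = (inner (fst v) (fst \<nu>))\<^sup>2"
    using assms(2) by (simp add: lorentz_eq power_mult_distrib)
  also have "\<dots> \<le> inner (fst v) (fst v) * inner (fst \<nu>) (fst \<nu>)"
    by (rule Cauchy_Schwarz_ineq)
  also have "\<dots> \<le> (snd v)\<^sup>2 * ((snd \<nu>)\<^sup>2 - 1)"
    unfolding a using le s1 by (rule mult_right_mono)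
  finally have "(snd v)\<^sup>2 \<le> 0"
    by (simp add: algebra_simps)
  then have "snd v = 0" by simp
  with le have "fst v = 0"
    by (metis inner_eq_zero_iff inner_ge_zero order_antisym power_zero_numeral)
  with \<open>snd v = 0\<close> assms(3) show False by (simp add: prod_eq_iff)
qed

text \<open>The ambient dimension is at least three, so two linear conditions have a common solution.\<close>

lemma exists_lorentz_orthogonal_to_two:
  fixes a b :: "'n::finite lorentz_space"
  obtains v where "v \<noteq> 0" "lorentz v a = 0" "lorentz v b = 0"
proof -
  define S where "S = {(fst a, - snd a), (fst b, - snd b)}"
  have "dim (span S) \<le> card S"
    by (simp add: S_def dim_le_card')
  also have "\<dots> \<le> 2" by (simp add: S_def card_insert_if)
  also have "2 < DIM('n lorentz_space)" by simp
  finally have "span S \<noteq> UNIV" by (metis dim_UNIV less_irrefl)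
  then obtain v where "v \<noteq> 0" "\<And>x. x \<in> span S \<Longrightarrow> orthogonal v x"
    using orthogonal_to_subspace_exists_gen[of S UNIV] by (auto simp: psubset_eq)
  then have "v \<noteq> 0" "lorentz v a = 0" "lorentz v b = 0"
    by (auto simp: lorentz_eq_inner orthogonal_def S_def span_base)
  then show thesis by (rule that)
qed

text \<open>At a point \<open>p\<close> of de Sitter space, where the position vector is normal to the hyperquadric,
  these are the vectors tangent to the hyperquadric and orthogonal to \<open>\<nu>\<close>. The description by
  linear equations does not refer to the leaf through \<open>p\<close>.\<close>

definition horizontal :: "'n::finite lorentz_space \<Rightarrow> 'n lorentz_space \<Rightarrow> 'n lorentz_space set" where
  "horizontal p \<nu> = {v. lorentz v p = 0 \<and> lorentz v \<nu> = 0}"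

lemma subspace_horizontal: "subspace (horizontal p \<nu>)"
  by (rule subspaceI) (auto simp: horizontal_def lorentz_simps)

text \<open>The vectors \<open>p\<close> and \<open>\<nu>\<close> span a nondegenerate plane, which therefore meets its orthogonal
  complement only in \<open>0\<close>.\<close>

lemma dim_horizontal_le:
  fixes p \<nu> :: "'n::finite lorentz_space"
  assumes "0 < lorentz p p" "lorentz \<nu> p = 0" "lorentz \<nu> \<nu> = -1"
  shows "dim (horizontal p \<nu>) \<le> CARD('n)"
proof -
  have "p \<notin> span {\<nu>}"
    using assms by (auto simp: span_singleton lorentz_simps)
  moreover have "\<nu> \<noteq> 0" using assms by (auto simp: lorentz_simps)
  ultimately have "independent {p, \<nu>}" "p \<noteq> \<nu>"
    by (auto simp: independent_insert span_base)
  then have dim2: "dim (span {p, \<nu>}) = 2"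
    by (simp add: dim_eq_card_independent)
  have "horizontal p \<nu> \<inter> span {p, \<nu>} = {0}"
  proof -
    have "v = 0" if h: "v \<in> horizontal p \<nu>" and s: "v \<in> span {p, \<nu>}" for v
    proof -
      obtain a b where v: "v = a *\<^sub>R p + b *\<^sub>R \<nu>"
        using s by (auto simp: span_insert algebra_simps)
      have "a * lorentz p p = 0" "b = 0"
        using h assms lorentz_commute[of p \<nu>] by (auto simp: horizontal_def v lorentz_simps)
      with assms(1) show "v = 0" by (simp add: v)
    qed
    then show ?thesis
      using subspace_0[OF subspace_horizontal] span_zero by blast
  qed
  then have "dim {x + y |x y. x \<in> horizontal p \<nu> \<and> y \<in> span {p, \<nu>}} = dim (horizontal p \<nu>) + 2"
    using dim_sums_Int[OF subspace_horizontal subspace_span, of p \<nu> "{p, \<nu>}"] dim2 by simp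
  moreover have "dim {x + y |x y. x \<in> horizontal p \<nu> \<and> y \<in> span {p, \<nu>}} \<le> DIM('n lorentz_space)"
    by (rule dim_subset_UNIV)
  ultimately show ?thesis by simp
qed

text \<open>The vectors \<open>p\<close>, \<open>\<nu>\<close> and the horizontal ones span the whole space.\<close>

lemma orthogonal_decomposition_zero:
  assumes c: "0 < c" and p: "lorentz p p = c" "lorentz \<nu> p = 0" "lorentz \<nu> \<nu> = -1"
    and u: "lorentz u p = 0" "lorentz u \<nu> = 0" "\<And>h. h \<in> horizontal p \<nu> \<Longrightarrow> lorentz u h = 0"
  shows "u = 0"
proof (rule lorentz_nondegenerate)
  fix w
  define h where "h = w - (lorentz w p / c) *\<^sub>R p + lorentz w \<nu> *\<^sub>R \<nu>"
  have "h \<in> horizontal p \<nu>"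
    using c p by (simp add: h_def horizontal_def lorentz_simps lorentz_commute[of p \<nu>])
  moreover have "w = h + (lorentz w p / c) *\<^sub>R p - lorentz w \<nu> *\<^sub>R \<nu>" by (simp add: h_def)
  then have "lorentz u w = lorentz u (h + (lorentz w p / c) *\<^sub>R p - lorentz w \<nu> *\<^sub>R \<nu>)" by simp
  ultimately show "lorentz u w = 0"
    using u by (simp add: lorentz_simps)
qed

text \<open>The function \<open>lorentz x x\<close> is constant on de Sitter space, and its Lorentz gradient is a multiple of \<open>p\<close>.\<close>

lemma tangent_space_de_sitter:
  assumes "v \<in> tangent_space (de_sitter c) p"
  shows "lorentz v p = 0"
proof -
  have "((\<lambda>x. lorentz x x) has_derivative (\<lambda>v. lorentz p v + lorentz v p)) (at p within de_sitter c)"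
    by (rule bounded_bilinear.FDERIV[OF bounded_bilinear_lorentz has_derivative_ident has_derivative_ident])
  moreover have "p \<in> de_sitter c"
    using assms unfolding tangent_space_def by force
  then have "((\<lambda>x. lorentz x x) has_derivative (\<lambda>v. 0)) (at p within de_sitter c)"
    by (intro has_derivative_transform[OF _ _ has_derivative_const[of c]]) (auto simp: de_sitter_def)
  ultimately have "lorentz p v + lorentz v p = 0"
    using assms derivative_unique_on_tangent_space by blast
  then show ?thesis by (simp add: lorentz_commute)
qed

section \<open>Tangent spaces of the leaves\<close>

lemma unit_normal_facts:
  assumes "unit_timelike_normal_field (de_sitter c) F N" "p \<in> de_sitter c"
  shows "N \<in> vector_fields (de_sitter c)" "lorentz (N p) (N p) = -1" "lorentz (N p) p = 0"
    "L \<in> F \<Longrightarrow> p \<in> L \<Longrightarrow> v \<in> tangent_space L p \<Longrightarrow> lorentz (N p) v = 0"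
proof -
  show "N \<in> vector_fields (de_sitter c)" "lorentz (N p) (N p) = -1"
    "L \<in> F \<Longrightarrow> p \<in> L \<Longrightarrow> v \<in> tangent_space L p \<Longrightarrow> lorentz (N p) v = 0"
    using assms unfolding unit_timelike_normal_field_def by blast+
  then have "N p \<in> tangent_space (de_sitter c) p"
    using assms(2) unfolding vector_fields_def by blast
  then show "lorentz (N p) p = 0" by (rule tangent_space_de_sitter)
qed

text \<open>The plaque through \<open>p\<close> provides an \<open>n\<close>-dimensional space of velocities of curves in the leaf.
  They are horizontal, and the space of horizontal vectors has dimension at most \<open>n\<close>, so every
  horizontal vector is one of them.\<close>

lemma horizontal_subset_tangent_space_leaf:
  fixes F :: "'n::finite lorentz_space set set"
  assumes c: "0 < c" and F: "foliation_on (de_sitter c) F"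
    and N: "unit_timelike_normal_field (de_sitter c) F N"
    and L: "L \<in> F" "p \<in> L"
  shows "horizontal p (N p) \<subseteq> tangent_space L p"
proof -
  have part: "partition_on (de_sitter c) F"
    using F by (simp add: foliation_on_def)
  then have LM: "L \<subseteq> de_sitter c" using L(1) by (auto simp: partition_on_def)
  with L have pM: "p \<in> de_sitter c" by blast
  obtain V :: "(real ^ 'n) set" and J :: "real set" and \<sigma>
    where VJ: "open V" "open J" and \<sigma>: "regular_param (de_sitter c) (V \<times> J) \<sigma>" "p \<in> \<sigma> ` (V \<times> J)"
      and comp: "components (L \<inter> \<sigma> ` (V \<times> J)) \<subseteq> {\<sigma> ` (V \<times> {y}) | y. y \<in> J}"
    using F pM L(1) unfolding foliation_on_def by meson
  obtain x0 y0 where p: "p = \<sigma> (x0, y0)" and xy: "x0 \<in> V" "y0 \<in> J"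
    using \<sigma>(2) by auto
  have inj: "inj_on \<sigma> (V \<times> J)" and sm: "smooth_on (V \<times> J) \<sigma>"
    and inj': "inj (frechet_derivative \<sigma> (at (x0, y0)))"
    using \<sigma>(1) xy by (auto simp: regular_param_def)
  \<comment> \<open>The component of \<open>p\<close> in the part of the leaf inside the chart is a plaque, and
    injectivity of \<open>\<sigma>\<close> identifies its height as that of \<open>p\<close>.\<close>
  have plaque: "\<sigma> ` (V \<times> {y0}) \<subseteq> L"
  proof -
    let ?C = "connected_component_set (L \<inter> \<sigma> ` (V \<times> J)) p"
    have pin: "p \<in> L \<inter> \<sigma> ` (V \<times> J)" using L(2) \<sigma>(2) by blast
    then have "?C \<in> components (L \<inter> \<sigma> ` (V \<times> J))"
      by (auto simp: components_def)
    then obtain y where y: "y \<in> J" "?C = \<sigma> ` (V \<times> {y})" using comp by blast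
    have "p \<in> \<sigma> ` (V \<times> {y})"
      using pin y(2) by (metis connected_component_refl_eq mem_Collect_eq)
    then have "y = y0" using inj xy y(1) unfolding p inj_on_def by auto
    then show ?thesis
      using y(2) connected_component_subset[of "L \<inter> \<sigma> ` (V \<times> J)" p] by blast
  qed
  have at: "at (x0, y0) within V \<times> J = at (x0, y0)"
    using VJ xy by (intro at_within_open open_Times) auto
  have d\<sigma>: "(\<sigma> has_derivative frechet_derivative \<sigma> (at (x0, y0))) (at (x0, y0))"
    using smooth_on_differentiable[OF sm, of "(x0, y0)"] xy
    by (simp add: at frechet_derivative_works)
  define A where "A = (\<lambda>u. frechet_derivative \<sigma> (at (x0, y0)) (u, 0))"
  have linA: "linear A"
  proof -
    interpret d: linear "frechet_derivative \<sigma> (at (x0, y0))"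
      using has_derivative_linear[OF d\<sigma>] .
    show ?thesis
      unfolding A_def using d.add[of "(u, 0)" "(w, 0)" for u w] d.scaleR[of _ "(u, 0)" for u]
      by (intro linearI) auto
  qed
  have injA: "inj A"
    using inj' unfolding A_def inj_def by auto
  have tan: "A u \<in> tangent_space L p" for u
  proof -
    let ?a = "\<lambda>t::real. t *\<^sub>R (u, 0::real) + (x0, y0)"
    have "open ((\<lambda>t. t *\<^sub>R u + x0) -` V)"
      using VJ(1) by (intro open_vimage continuous_intros)
    moreover have "0 \<in> (\<lambda>t. t *\<^sub>R u + x0) -` V" using xy by simp
    ultimately obtain e where e: "0 < e" "ball 0 e \<subseteq> (\<lambda>t. t *\<^sub>R u + x0) -` V"
      using open_contains_ball by blast
    have inV: "t *\<^sub>R u + x0 \<in> V" if "t \<in> {-e<..<e}" for t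
      using e(2) that by (auto simp: subset_iff dist_real_def)
    have "smooth_on {-e<..<e} (\<lambda>t. \<sigma> (?a t))"
      by (rule smooth_on_compose_affine[OF sm bounded_linear_scaleR_left]) (use inV xy in auto)
    moreover have "(\<lambda>t. \<sigma> (?a t)) ` {-e<..<e} \<subseteq> L"
      using inV plaque by auto
    moreover have "((\<lambda>t. \<sigma> (?a t)) has_vector_derivative A u) (at 0)"
      unfolding A_def
      by (rule has_vector_derivative_along[where M = UNIV])
        (auto simp: d\<sigma> zero_prod_def[symmetric] intro!: derivative_eq_intros)
    ultimately show ?thesis
      unfolding tangent_space_def using e(1)
      by (auto simp: p intro!: exI[of _ "\<lambda>t. \<sigma> (?a t)"] exI[of _ e])
  qed
  have "A u \<in> horizontal p (N p)" for u
  proof -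
    have "A u \<in> tangent_space (de_sitter c) p"
      using tan tangent_space_mono[OF LM] by blast
    then show ?thesis
      using unit_normal_facts(4)[OF N pM L tan[of u]]
      by (simp add: horizontal_def tangent_space_de_sitter lorentz_commute[of "A u" "N p"])
  qed
  then have "range A \<subseteq> horizontal p (N p)" by blast
  moreover have "dim (range A) = CARD('n)"
    using dim_image_eq[OF linA, of UNIV] injA by simp
  moreover have "dim (horizontal p (N p)) \<le> CARD('n)"
    using pM c unit_normal_facts[OF N pM] by (intro dim_horizontal_le) (auto simp: de_sitter_def)
  ultimately have "range A = horizontal p (N p)"
    using linA by (intro subspace_dim_equal subspace_horizontal) (auto simp: linear_subspace_image)
  with tan show ?thesis by (metis rangeE subsetI)
qed

text \<open>A constant vector field projected orthogonally to the horizontal spaces is tangent to all leaves.\<close>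

lemma exists_horizontal_field:
  assumes c: "0 < c" and F: "foliation_on (de_sitter c) F"
    and N: "unit_timelike_normal_field (de_sitter c) F N"
    and p: "p \<in> de_sitter c" and v: "v \<in> horizontal p (N p)"
  obtains X where "X \<in> vector_fields (de_sitter c)" "X p = v"
    "\<And>L q. L \<in> F \<Longrightarrow> q \<in> L \<Longrightarrow> X q \<in> tangent_space L q"
    "\<And>q. q \<in> de_sitter c \<Longrightarrow> X q \<in> horizontal q (N q)"
proof -
  let ?M = "de_sitter c"
  define X where "X = (\<lambda>x. (v + (- lorentz v x / c) *\<^sub>R x) + lorentz v (N x) *\<^sub>R N x)"
  have smN: "smooth_on ?M N"
    using unit_normal_facts(1)[OF N p] by (simp add: vector_fields_def)
  have "smooth_on ?M (\<lambda>x. (- lorentz v x / c) *\<^sub>R x)"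
    using bounded_bilinear.bounded_linear_right[OF bounded_bilinear_lorentz, of v]
    by (intro smooth_on_bilinear[OF bounded_bilinear_scaleR] smooth_on_bounded_linear
        bounded_linear_ident bounded_linear_divide[THEN bounded_linear_compose] bounded_linear_minus)
  moreover have "smooth_on ?M (\<lambda>x. lorentz v (N x) *\<^sub>R N x)"
    by (intro smooth_on_bilinear[OF bounded_bilinear_scaleR] smN
        smooth_on_bilinear[OF bounded_bilinear_lorentz] smooth_on_const)
  ultimately have sm: "smooth_on ?M X"
    unfolding X_def by (intro smooth_on_add smooth_on_const)
  have hor: "X q \<in> horizontal q (N q)" if "q \<in> ?M" for q
    using unit_normal_facts(2,3)[OF N that] c that
    by (simp add: X_def horizontal_def lorentz_simps lorentz_commute[of q "N q"] de_sitter_def)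
  have part: "\<Union>F = ?M"
    using F by (simp add: foliation_on_def partition_on_def)
  have tan: "X q \<in> tangent_space L q" if "L \<in> F" "q \<in> L" for L q
    using horizontal_subset_tangent_space_leaf[OF c F N that] hor[of q] part that by blast
  have "X q \<in> tangent_space ?M q" if "q \<in> ?M" for q
  proof -
    obtain L where L: "L \<in> F" "q \<in> L" using part \<open>q \<in> ?M\<close> by blast
    then have "L \<subseteq> ?M" using part by blast
    with tan[OF L] show ?thesis using tangent_space_mono by blast
  qed
  with sm have "X \<in> vector_fields ?M" by (simp add: vector_fields_def)
  moreover have "X p = v" using v by (simp add: X_def horizontal_def)
  ultimately show thesis using tan hor by (rule that)
qed

section \<open>The Levi-Civita connection and the ambient derivative\<close>

definition ambient_derivative ::
    "'a::real_normed_vector set \<Rightarrow> ('a \<Rightarrow> 'a) \<Rightarrow> ('a \<Rightarrow> 'a) \<Rightarrow> 'a \<Rightarrow> 'a" where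
  "ambient_derivative M X Y p = frechet_derivative Y (at p within M) (X p)"

lemma vector_field_has_derivative:
  "Y \<in> vector_fields M \<Longrightarrow> p \<in> M \<Longrightarrow>
    (Y has_derivative frechet_derivative Y (at p within M)) (at p within M)"
  using smooth_on_differentiable[of M Y p]
  by (simp add: vector_fields_def frechet_derivative_works)

lemma deriv_along_eq:
  assumes "X \<in> vector_fields M" "p \<in> M" "(g has_derivative A) (at p within M)"
    and "\<And>x. x \<in> M \<Longrightarrow> f x = g x"
  shows "deriv_along M X f p = A (X p)"
proof -
  have "(f has_derivative A) (at p within M)"
    using assms(2-4) by (intro has_derivative_transform[OF _ _ assms(3)]) auto
  then show ?thesis
    using assms(1,2) unfolding deriv_along_def
    by (intro frechet_derivative_on_tangent_space) (auto simp: vector_fields_def)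
qed

lemma deriv_along_lorentz:
  assumes "X \<in> vector_fields M" "Y \<in> vector_fields M" "Z \<in> vector_fields M" "p \<in> M"
  shows "deriv_along M X (\<lambda>x. lorentz (Y x) (Z x)) p =
    lorentz (ambient_derivative M X Y p) (Z p) + lorentz (Y p) (ambient_derivative M X Z p)"
  unfolding ambient_derivative_def
  using deriv_along_eq[OF assms(1,4) bounded_bilinear.FDERIV[OF bounded_bilinear_lorentz
      vector_field_has_derivative[OF assms(2,4)] vector_field_has_derivative[OF assms(3,4)]]]
  by simp

lemma deriv_along_lorentz_position:
  assumes "X \<in> vector_fields M" "Y \<in> vector_fields M" "p \<in> M"
  shows "deriv_along M X (\<lambda>x. lorentz (Y x) x) p =
    lorentz (ambient_derivative M X Y p) p + lorentz (Y p) (X p)"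
  unfolding ambient_derivative_def
  using deriv_along_eq[OF assms(1,3) bounded_bilinear.FDERIV[OF bounded_bilinear_lorentz
      vector_field_has_derivative[OF assms(2,3)] has_derivative_ident]]
  by simp

lemma deriv_along_constant:
  assumes "X \<in> vector_fields M" "p \<in> M" "\<And>x. x \<in> M \<Longrightarrow> f x = k"
  shows "deriv_along M X f p = 0"
  using deriv_along_eq[OF assms(1,2) has_derivative_const assms(3)] by simp

lemma levi_civita_closed:
  assumes "levi_civita M D" "X \<in> vector_fields M" "Y \<in> vector_fields M"
  shows "D X Y \<in> vector_fields M"
  by (rule assms(1)[unfolded levi_civita_def, THEN conjunct1, THEN bspec, THEN bspec, OF assms(2,3)])

lemma levi_civita_metric:
  assumes "levi_civita M D" "X \<in> vector_fields M" "Y \<in> vector_fields M" "Z \<in> vector_fields M"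
    and "p \<in> M"
  shows "deriv_along M X (\<lambda>x. lorentz (Y x) (Z x)) p =
    lorentz (D X Y p) (Z p) + lorentz (Y p) (D X Z p)"
  by (rule assms(1)[unfolded levi_civita_def, THEN conjunct2, THEN conjunct2, THEN conjunct2,
        THEN conjunct2, THEN conjunct2, THEN conjunct1, THEN bspec, THEN bspec, THEN bspec, THEN bspec,
        OF assms(2-5)])

lemma levi_civita_bracket:
  assumes "levi_civita M D" "X \<in> vector_fields M" "Y \<in> vector_fields M" "smooth_on M f" "p \<in> M"
  shows "deriv_along M (\<lambda>x. D X Y x - D Y X x) f p =
    deriv_along M X (deriv_along M Y f) p - deriv_along M Y (deriv_along M X f) p"
  by (rule assms(1)[unfolded levi_civita_def, THEN conjunct2, THEN conjunct2, THEN conjunct2,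
        THEN conjunct2, THEN conjunct2, THEN conjunct2, THEN bspec, THEN bspec, THEN spec, THEN mp,
        THEN bspec, OF assms(2-5)])

text \<open>Linear functions suffice as test functions in the bracket identity: on them the second
  derivatives of the function vanish, and together they separate vectors.\<close>

lemma levi_civita_torsion_free:
  assumes D: "levi_civita M D" and X: "X \<in> vector_fields M" and Y: "Y \<in> vector_fields M"
    and p: "p \<in> M"
  shows "D X Y p - D Y X p = ambient_derivative M X Y p - ambient_derivative M Y X p"
proof -
  note DXY = levi_civita_closed[OF D]
  have "lorentz (D X Y p - D Y X p - (ambient_derivative M X Y p - ambient_derivative M Y X p)) w = 0"
    for w
  proof -
    let ?f = "\<lambda>x. lorentz x w"
    have bl: "bounded_linear ?f"
      by (rule bounded_bilinear.bounded_linear_left[OF bounded_bilinear_lorentz])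
    have f': "(?f has_derivative ?f) (at x within M)" for x
      by (rule bounded_linear_imp_has_derivative[OF bl])
    have first: "deriv_along M Z ?f x = lorentz (Z x) w" if "Z \<in> vector_fields M" "x \<in> M" for Z x
      using deriv_along_eq[OF that f'] by simp
    have second: "deriv_along M Z (deriv_along M Z' ?f) p = lorentz (ambient_derivative M Z Z' p) w"
      if "Z \<in> vector_fields M" "Z' \<in> vector_fields M" for Z Z'
      unfolding ambient_derivative_def
      by (rule deriv_along_eq[OF that(1) p
            bounded_linear.has_derivative[OF bl vector_field_has_derivative[OF that(2) p]]
            first[OF that(2)]])
    have "frechet_derivative ?f (at p within M) (D X Y p - D Y X p) =
        frechet_derivative ?f (at p within M) (D X Y p) - frechet_derivative ?f (at p within M) (D Y X p)"
      using linear_diff[OF has_derivative_linear] f'[of p] frechet_derivative_works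
      unfolding differentiable_def by blast
    also have "\<dots> = lorentz (D X Y p) w - lorentz (D Y X p) w"
      using first[OF DXY p] X Y by (simp add: deriv_along_def)
    finally have "lorentz (D X Y p) w - lorentz (D Y X p) w =
        deriv_along M (\<lambda>x. D X Y x - D Y X x) ?f p"
      by (simp add: deriv_along_def)
    also have "\<dots> = deriv_along M X (deriv_along M Y ?f) p - deriv_along M Y (deriv_along M X ?f) p"
      by (rule levi_civita_bracket[OF D X Y smooth_on_bounded_linear[OF bl] p])
    finally show ?thesis
      using second[OF X Y] second[OF Y X] by (simp add: lorentz_simps)
  qed
  then have "D X Y p - D Y X p - (ambient_derivative M X Y p - ambient_derivative M Y X p) = 0"
    by (rule lorentz_nondegenerate)
  then show ?thesis by simp
qed

text \<open>The uniqueness argument for the Levi-Civita connection: the tangential part of the ambient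
  derivative is also metric and torsion-free, so the difference \<open>T\<close>, paired with a third field, is
  symmetric in its first two arguments and skew in its last two. Permuting cyclically
  gives \<open>T = -T\<close>.\<close>

lemma levi_civita_tangential_part:
  assumes D: "levi_civita M D" and XYZ: "X \<in> vector_fields M" "Y \<in> vector_fields M" "Z \<in> vector_fields M"
    and p: "p \<in> M"
  shows "lorentz (D X Y p) (Z p) = lorentz (ambient_derivative M X Y p) (Z p)"
proof -
  define T where "T = (\<lambda>X Y. D X Y p - ambient_derivative M X Y p)"
  have sym: "T X Y = T Y X" if "X \<in> vector_fields M" "Y \<in> vector_fields M" for X Y
    using levi_civita_torsion_free[OF D that p] by (simp add: T_def algebra_simps)
  have skew: "lorentz (T X Y) (Z p) = - lorentz (T X Z) (Y p)"
    if "X \<in> vector_fields M" "Y \<in> vector_fields M" "Z \<in> vector_fields M" for X Y Z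
  proof -
    have "deriv_along M X (\<lambda>x. lorentz (Y x) (Z x)) p =
        lorentz (D X Y p) (Z p) + lorentz (Y p) (D X Z p)"
      by (rule levi_civita_metric[OF D that p])
    with deriv_along_lorentz[OF that p] show ?thesis
      by (simp add: T_def lorentz_simps lorentz_commute[of "Y p"])
  qed
  have "lorentz (T X Y) (Z p) = - lorentz (T X Y) (Z p)"
    using skew[of X Y Z] skew[of Z X Y] skew[of Y Z X] sym[of X Y] sym[of X Z] sym[of Y Z] XYZ by simp
  then show ?thesis by (simp add: T_def lorentz_simps)
qed

section \<open>The derivative of the normal field\<close>

text \<open>The Gauss map of a totally geodesic leaf is constant to first order. The derivative of \<open>N\<close> in a
  horizontal direction is orthogonal to \<open>N\<close> because \<open>N\<close> has constant length, to the position vector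
  because \<open>N\<close> is tangent to the hyperquadric and \<open>v\<close> is orthogonal to \<open>N\<close>, and to every horizontal
  vector because the second fundamental form vanishes.\<close>

lemma normal_derivative_zero:
  assumes c: "0 < c" and D: "levi_civita (de_sitter c) D"
    and F: "foliation_on (de_sitter c) F"
    and N: "unit_timelike_normal_field (de_sitter c) F N"
    and geod: "\<And>L. L \<in> F \<Longrightarrow> totally_geodesic_leaf (de_sitter c) D N L"
    and p: "p \<in> de_sitter c" and v: "v \<in> horizontal p (N p)"
  shows "frechet_derivative N (at p within de_sitter c) v = 0"
proof -
  let ?M = "de_sitter c"
  note NF = unit_normal_facts(1)[OF N p] and NN = unit_normal_facts(2)[OF N] and Np = unit_normal_facts(3)[OF N]
  obtain X where X: "X \<in> vector_fields ?M" "X p = v"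
    "\<And>L q. L \<in> F \<Longrightarrow> q \<in> L \<Longrightarrow> X q \<in> tangent_space L q"
    using exists_horizontal_field[OF c F N p v] by metis
  have "\<Union>F = ?M" using F by (simp add: foliation_on_def partition_on_def)
  with p obtain L where L: "L \<in> F" "p \<in> L" by blast
  let ?u = "ambient_derivative ?M X N p"
  have pc: "lorentz p p = c" using p by (simp add: de_sitter_def)
  have u_horizontal: "lorentz ?u h = 0" if h: "h \<in> horizontal p (N p)" for h
  proof -
    obtain Z where Z: "Z \<in> vector_fields ?M" "Z p = h"
      "\<And>L q. L \<in> F \<Longrightarrow> q \<in> L \<Longrightarrow> Z q \<in> tangent_space L q"
      "\<And>q. q \<in> ?M \<Longrightarrow> Z q \<in> horizontal q (N q)"
      using exists_horizontal_field[OF c F N p h] by metis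
    have "normal_part (N p) (D X Z p) = 0"
      using geod[OF L(1)] X(1) Z(1) X(3)[OF L(1)] Z(3)[OF L(1)] L(2)
      unfolding totally_geodesic_leaf_def by blast
    moreover have "N p \<noteq> 0" using NN[OF p] by (auto simp: lorentz_simps)
    ultimately have "lorentz (D X Z p) (N p) = 0" by (simp add: normal_part_def)
    then have "lorentz (ambient_derivative ?M X Z p) (N p) = 0"
      using levi_civita_tangential_part[OF D X(1) Z(1) NF p] by simp
    moreover have "deriv_along ?M X (\<lambda>x. lorentz (Z x) (N x)) p = 0"
      using Z(4) by (intro deriv_along_constant[OF X(1) p, of _ 0]) (auto simp: horizontal_def)
    ultimately show ?thesis
      using deriv_along_lorentz[OF X(1) Z(1) NF p] Z(2) by (simp add: lorentz_commute)
  qed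
  have u_normal: "lorentz ?u (N p) = 0"
    using deriv_along_lorentz[OF X(1) NF NF p]
      deriv_along_constant[OF X(1) p, of "\<lambda>x. lorentz (N x) (N x)" "-1"] NN
    by (simp add: lorentz_commute)
  have u_position: "lorentz ?u p = 0"
    using deriv_along_lorentz_position[OF X(1) NF p]
      deriv_along_constant[OF X(1) p, of "\<lambda>x. lorentz (N x) x" 0] Np v X(2)
    by (simp add: horizontal_def lorentz_commute[of "N p" v])
  have "?u = 0"
    by (rule orthogonal_decomposition_zero[OF c pc Np[OF p] NN[OF p] u_position u_normal u_horizontal])
  then show ?thesis by (simp add: ambient_derivative_def X(2))
qed

text \<open>This is the Gauss formula of the hyperquadric for the field \<open>N\<close>. It shows that the ambient
  derivative of \<open>N\<close> in the direction \<open>N\<close> depends continuously on the point, which gives the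
  Lipschitz constant for the differential inequality along great circles.\<close>

lemma normal_derivative_along_normal:
  assumes c: "0 < c" and D: "levi_civita (de_sitter c) D"
    and F: "foliation_on (de_sitter c) F"
    and N: "unit_timelike_normal_field (de_sitter c) F N"
    and p: "p \<in> de_sitter c"
  shows "frechet_derivative N (at p within de_sitter c) (N p) = D N N p + (1 / c) *\<^sub>R p"
proof -
  let ?M = "de_sitter c"
  note NF = unit_normal_facts(1)[OF N p] and NN = unit_normal_facts(2)[OF N] and Np = unit_normal_facts(3)[OF N]
  let ?u = "ambient_derivative ?M N N p - D N N p - (1 / c) *\<^sub>R p"
  have pc: "lorentz p p = c" using p by (simp add: de_sitter_def)
  have u_horizontal: "lorentz ?u h = 0" if h: "h \<in> horizontal p (N p)" for h
  proof -
    obtain Z where Z: "Z \<in> vector_fields ?M" "Z p = h"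
      using exists_horizontal_field[OF c F N p h] by metis
    then show ?thesis
      using levi_civita_tangential_part[OF D NF NF Z(1) p] h
      by (simp add: lorentz_simps horizontal_def lorentz_commute[of p])
  qed
  have u_normal: "lorentz ?u (N p) = 0"
    using levi_civita_tangential_part[OF D NF NF NF p] Np[OF p]
    by (simp add: lorentz_simps lorentz_commute[of p])
  have u_position: "lorentz ?u p = 0"
  proof -
    have "D N N \<in> vector_fields ?M" by (rule levi_civita_closed[OF D NF NF])
    then have "lorentz (D N N p) p = 0"
      using p by (intro tangent_space_de_sitter[of _ c]) (simp add: vector_fields_def)
    then show ?thesis
      using deriv_along_lorentz_position[OF NF NF p]
        deriv_along_constant[OF NF p, of "\<lambda>x. lorentz (N x) x" 0] Np NN[OF p] c p
      by (simp add: lorentz_simps de_sitter_def)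
  qed
  have "?u = 0"
    by (rule orthogonal_decomposition_zero[OF c pc Np[OF p] NN[OF p] u_position u_normal u_horizontal])
  then show ?thesis by (simp add: ambient_derivative_def algebra_simps)
qed

section \<open>Constancy of the normal on great spheres\<close>

text \<open>Gronwall's argument: the squared norm times \<open>exp (-2 K t)\<close> is nonincreasing.\<close>

lemma zero_if_derivative_bounded_by_self:
  fixes f :: "real \<Rightarrow> 'a::real_inner"
  assumes f': "\<And>t. 0 \<le> t \<Longrightarrow> t \<le> b \<Longrightarrow> (f has_vector_derivative f' t) (at t)"
    and bound: "\<And>t. 0 \<le> t \<Longrightarrow> t \<le> b \<Longrightarrow> norm (f' t) \<le> K * norm (f t)"
    and "f 0 = 0" "0 \<le> b"
  shows "f b = 0"
proof -
  define \<phi> where "\<phi> = (\<lambda>t. inner (f t) (f t) * exp (- (2 * K * t)))"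
  have "\<phi> b \<le> \<phi> 0"
  proof (rule DERIV_nonpos_imp_nonincreasing[OF \<open>0 \<le> b\<close>])
    fix t assume t: "0 \<le> t" "t \<le> b"
    have "((\<lambda>t. inner (f t) (f t)) has_derivative
        (\<lambda>h. inner (f t) (h *\<^sub>R f' t) + inner (h *\<^sub>R f' t) (f t))) (at t)"
      using f'[OF t] unfolding has_vector_derivative_def by (intro has_derivative_inner)
    then have "((\<lambda>t. inner (f t) (f t)) has_field_derivative 2 * inner (f t) (f' t)) (at t)"
      by (simp add: has_field_derivative_def inner_commute[of "f' t"] mult.commute
          mult_commute_abs algebra_simps)
    then have "(\<phi> has_field_derivative
        2 * (inner (f t) (f' t) - K * inner (f t) (f t)) * exp (- (2 * K * t))) (at t)"
      unfolding \<phi>_def by (auto intro!: derivative_eq_intros simp: algebra_simps)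
    moreover have "inner (f t) (f' t) \<le> K * inner (f t) (f t)"
    proof -
      have "inner (f t) (f' t) \<le> norm (f t) * norm (f' t)" by (rule norm_cauchy_schwarz)
      also have "\<dots> \<le> norm (f t) * (K * norm (f t))"
        using bound[OF t] by (intro mult_left_mono) auto
      finally show ?thesis
        by (simp add: dot_square_norm power2_eq_square algebra_simps)
    qed
    then have "2 * (inner (f t) (f' t) - K * inner (f t) (f t)) * exp (- (2 * K * t)) \<le> 0"
      by (simp add: mult_le_0_iff)
    ultimately show "\<exists>y. (\<phi> has_field_derivative y) (at t) \<and> y \<le> 0" by blast
  qed
  then have "inner (f b) (f b) \<le> 0"
    using \<open>f 0 = 0\<close> by (simp add: \<phi>_def mult_le_0_iff)
  then show ?thesis by (metis inner_eq_zero_iff inner_ge_zero order_antisym)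
qed

lemma abs_lorentz_le: "\<bar>lorentz v w\<bar> \<le> norm v * norm w"
proof -
  have "norm (fst w, - snd w) = norm w" by (simp add: norm_prod_def)
  then show ?thesis unfolding lorentz_eq_inner using Cauchy_Schwarz_ineq2[of v "(fst w, - snd w)"] by simp
qed

text \<open>Nothing tells in advance that a great circle \<open>\<gamma>\<close> starting in the leaf of \<open>q\<close> stays in this
  leaf, so its velocity may have a component along \<open>N\<close>. Since \<open>N\<close> has zero derivative in
  horizontal directions, only this component contributes to the derivative of \<open>N\<close> along \<open>\<gamma>\<close>. As
  \<open>\<gamma>'\<close> is orthogonal to \<open>N q\<close>, the component is linear in the deviation \<open>f\<close> of \<open>N\<close> from \<open>N q\<close>.
  So \<open>f\<close> satisfies a linear differential equation with initial value \<open>0\<close>.\<close>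

lemma normal_constant_on_great_circle:
  fixes N :: "'n::finite lorentz_space \<Rightarrow> 'n lorentz_space" and c :: real
  defines "M \<equiv> de_sitter c"
  assumes N: "\<And>x. x \<in> M \<Longrightarrow> (N has_derivative dN x) (at x within M)"
    and NN: "\<And>x. x \<in> M \<Longrightarrow> lorentz (N x) (N x) = -1" "\<And>x. x \<in> M \<Longrightarrow> lorentz (N x) x = 0"
    and leafwise: "\<And>x v. x \<in> M \<Longrightarrow> v \<in> horizontal x (N x) \<Longrightarrow> dN x v = 0"
    and cont: "continuous_on M (\<lambda>x. dN x (N x))"
    and q: "q \<in> M" and e: "e \<in> horizontal q (N q)" "lorentz e e = c" and b: "0 \<le> b"
  shows "N (cos b *\<^sub>R q + sin b *\<^sub>R e) = N q"
proof -
  define \<gamma> where "\<gamma> = (\<lambda>t. cos t *\<^sub>R q + sin t *\<^sub>R e)"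
  define \<gamma>' where "\<gamma>' = (\<lambda>t. cos t *\<^sub>R e - sin t *\<^sub>R q)"
  define f where "f = (\<lambda>t. N (\<gamma> t) - N q)"
  have qq: "lorentz q q = c" and eq: "lorentz e q = 0" "lorentz q e = 0"
    and eN: "lorentz e (N q) = 0" and qN: "lorentz q (N q) = 0"
    using q e NN(2)[OF q] by (simp_all add: M_def de_sitter_def horizontal_def lorentz_commute[of q e] lorentz_commute[of q "N q"])
  have \<gamma>M: "\<gamma> t \<in> M" for t
  proof -
    have "lorentz (\<gamma> t) (\<gamma> t) = c * (cos t * cos t) + c * (sin t * sin t)"
      by (simp add: \<gamma>_def lorentz_simps qq eq e(2) algebra_simps)
    also have "\<dots> = c"
      by (simp add: distrib_left[symmetric])
    finally show ?thesis by (simp add: M_def de_sitter_def)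
  qed
  have \<gamma>deriv: "(\<gamma> has_vector_derivative \<gamma>' t) (at t)" for t
    unfolding \<gamma>_def \<gamma>'_def by (auto intro!: derivative_eq_intros)
  have f': "(f has_vector_derivative dN (\<gamma> t) (\<gamma>' t)) (at t)" for t
    unfolding f_def
    using has_vector_derivative_along[OF N[OF \<gamma>M] \<gamma>deriv] \<gamma>M
    by (auto intro!: derivative_eq_intros)
  have dN_eq: "dN (\<gamma> t) (\<gamma>' t) = - (lorentz (\<gamma>' t) (f t) *\<^sub>R dN (\<gamma> t) (N (\<gamma> t)))" for t
  proof -
    interpret d: linear "dN (\<gamma> t)" using N[OF \<gamma>M] by (rule has_derivative_linear)
    let ?s = "lorentz (\<gamma>' t) (N (\<gamma> t))"
    have "lorentz (\<gamma>' t) (\<gamma> t) = 0"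
      by (simp add: \<gamma>_def \<gamma>'_def lorentz_simps qq eq e(2))
    then have "\<gamma>' t + ?s *\<^sub>R N (\<gamma> t) \<in> horizontal (\<gamma> t) (N (\<gamma> t))"
      using NN[OF \<gamma>M, of t] by (simp add: horizontal_def lorentz_simps)
    then have "dN (\<gamma> t) (\<gamma>' t) + ?s *\<^sub>R dN (\<gamma> t) (N (\<gamma> t)) = 0"
      using leafwise[OF \<gamma>M] by (simp add: d.add[symmetric] d.scaleR[symmetric])
    moreover have "?s = lorentz (\<gamma>' t) (f t)"
      by (simp add: f_def \<gamma>'_def lorentz_simps eN qN)
    ultimately show ?thesis by (simp add: eq_neg_iff_add_eq_0)
  qed
  have "continuous_on {0..b} (\<lambda>t. dN (\<gamma> t) (N (\<gamma> t)))"
    using cont \<gamma>M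
    by (rule_tac continuous_on_compose2[of M _ _ \<gamma>])
      (auto intro!: continuous_at_imp_continuous_on has_vector_derivative_continuous[OF \<gamma>deriv])
  then have "bounded ((\<lambda>t. dN (\<gamma> t) (N (\<gamma> t))) ` {0..b})"
    by (intro compact_imp_bounded compact_continuous_image) auto
  then obtain C where C: "0 < C" "\<And>t. 0 \<le> t \<Longrightarrow> t \<le> b \<Longrightarrow> norm (dN (\<gamma> t) (N (\<gamma> t))) \<le> C"
    by (auto simp: bounded_pos)
  have "f b = 0"
  proof (rule zero_if_derivative_bounded_by_self[where f = f and K = "(norm e + norm q) * C"])
    show "(f has_vector_derivative dN (\<gamma> t) (\<gamma>' t)) (at t)" for t by (rule f')
    show "norm (dN (\<gamma> t) (\<gamma>' t)) \<le> (norm e + norm q) * C * norm (f t)" if "0 \<le> t" "t \<le> b" for t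
    proof -
      have "norm (\<gamma>' t) \<le> \<bar>cos t\<bar> * norm e + \<bar>sin t\<bar> * norm q"
        unfolding \<gamma>'_def by (rule order_trans[OF norm_triangle_ineq4]) simp
      also have "\<dots> \<le> 1 * norm e + 1 * norm q"
        by (intro add_mono mult_right_mono) auto
      finally have "norm (\<gamma>' t) \<le> norm e + norm q" by simp
      then have "\<bar>lorentz (\<gamma>' t) (f t)\<bar> \<le> (norm e + norm q) * norm (f t)"
        using abs_lorentz_le[of "\<gamma>' t" "f t"] by (meson mult_right_mono norm_ge_zero order_trans)
      then have "\<bar>lorentz (\<gamma>' t) (f t)\<bar> * norm (dN (\<gamma> t) (N (\<gamma> t))) \<le>
          (norm e + norm q) * norm (f t) * C"
        using C(2)[OF that] by (intro mult_mono) auto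
      then show ?thesis by (simp add: dN_eq ac_simps)
    qed
    show "f 0 = 0" by (simp add: f_def \<gamma>_def)
    show "0 \<le> b" by (rule b)
  qed
  then show ?thesis by (simp add: f_def \<gamma>_def)
qed

lemma lorentz_normalize:
  assumes "0 < c" "0 < lorentz v v"
  shows "lorentz (sqrt (c / lorentz v v) *\<^sub>R v) (sqrt (c / lorentz v v) *\<^sub>R v) = c"
proof -
  have "lorentz (sqrt (c / lorentz v v) *\<^sub>R v) (sqrt (c / lorentz v v) *\<^sub>R v) =
      (sqrt (c / lorentz v v))\<^sup>2 * lorentz v v"
    by (simp only: lorentz_simps real_scaleR_def power2_eq_square ac_simps)
  then show ?thesis using assms by simp
qed

text \<open>Split \<open>y\<close> into its component along \<open>q\<close> and a remainder \<open>z\<close>. Positivity of the metric on the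
  complement of \<open>\<nu>\<close> makes the coefficient \<open>a\<close> of \<open>q\<close> a cosine, and \<open>e\<close> is \<open>z\<close> rescaled.\<close>

lemma great_sphere_covered_by_great_circles:
  fixes q \<nu> y :: "'n::finite lorentz_space"
  assumes c: "0 < c" and q: "q \<in> de_sitter c" "lorentz q \<nu> = 0" and \<nu>: "lorentz \<nu> \<nu> = -1"
    and y: "y \<in> de_sitter c" "lorentz y \<nu> = 0"
  obtains b e where "0 \<le> b" "e \<in> horizontal q \<nu>" "lorentz e e = c"
    "y = cos b *\<^sub>R q + sin b *\<^sub>R e"
proof -
  define a where "a = lorentz y q / c"
  define z where "z = y - a *\<^sub>R q"
  have qq: "lorentz q q = c" and yy: "lorentz y y = c"
    using q(1) y(1) by (auto simp: de_sitter_def)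
  have yq: "lorentz y q = a * c" "lorentz q y = a * c"
    using c by (simp_all add: a_def lorentz_commute[of q y])
  have z: "z \<in> horizontal q \<nu>"
    using q(2) y(2) qq yq by (simp add: z_def horizontal_def lorentz_simps)
  have zz: "lorentz z z = c * (1 - a\<^sup>2)"
    by (simp add: z_def lorentz_simps qq yy yq power2_eq_square algebra_simps)
  have pos: "0 < lorentz v v" if "v \<in> horizontal q \<nu>" "v \<noteq> 0" for v
    using lorentz_pos_on_timelike_complement[OF \<nu>] that by (simp add: horizontal_def)
  have "0 \<le> lorentz z z" using pos[OF z] by (cases "z = 0") (auto simp: lorentz_simps)
  then have "a\<^sup>2 \<le> 1" using c by (simp add: zz zero_le_mult_iff)
  then have a: "-1 \<le> a" "a \<le> 1" by (auto simp: abs_square_le_1 abs_le_iff)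
  obtain e where e: "e \<in> horizontal q \<nu>" "lorentz e e = c" "sqrt (1 - a\<^sup>2) *\<^sub>R e = z"
  proof (cases "z = 0")
    case True
    \<comment> \<open>Here \<open>y\<close> is \<open>q\<close> or its antipode, and every great circle through \<open>q\<close> contains it.\<close>
    obtain v where "v \<noteq> 0" "lorentz v q = 0" "lorentz v \<nu> = 0"
      by (rule exists_lorentz_orthogonal_to_two)
    then have v: "v \<noteq> 0" "v \<in> horizontal q \<nu>" by (simp_all add: horizontal_def)
    have "1 - a\<^sup>2 = 0" using zz c True by (simp add: lorentz_simps)
    then show thesis
      using that[of "sqrt (c / lorentz v v) *\<^sub>R v"] lorentz_normalize[OF c pos[OF v(2,1)]]
        subspace_scale[OF subspace_horizontal v(2)] True by simp
  next
    case False
    have "0 < c * (1 - a\<^sup>2)" using pos[OF z False] by (simp add: zz)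
    then have "0 < 1 - a\<^sup>2" using c by (simp add: zero_less_mult_iff)
    then have "sqrt (1 - a\<^sup>2) * sqrt (c / lorentz z z) = 1"
      using c by (simp add: zz real_sqrt_mult[symmetric])
    then show thesis
      using that[of "sqrt (c / lorentz z z) *\<^sub>R z"] lorentz_normalize[OF c pos[OF z False]]
        subspace_scale[OF subspace_horizontal z] by simp
  qed
  have "y = cos (arccos a) *\<^sub>R q + sin (arccos a) *\<^sub>R e"
    using a by (simp add: sin_arccos cos_arccos e(3)) (simp add: z_def)
  then show thesis using that e(1,2) arccos_lbound[OF a] by blast
qed

section \<open>Great spheres intersect\<close>

theorem corollary5p3:
  fixes c :: real
    and F :: "'n::finite lorentz_space set set"
    and N :: "'n lorentz_space \<Rightarrow> 'n lorentz_space"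
    and D :: "('n lorentz_space \<Rightarrow> 'n lorentz_space) \<Rightarrow> ('n lorentz_space \<Rightarrow> 'n lorentz_space) \<Rightarrow>
              'n lorentz_space \<Rightarrow> 'n lorentz_space"
  assumes "c > 0"
    and "levi_civita (de_sitter c) D"
    and "spacelike_foliation_on (de_sitter c) F"
    and "unit_timelike_normal_field (de_sitter c) F N"
    and "leafwise_L1 F N (D N N)"
  shows "\<not> ((\<forall>L\<in>F. totally_geodesic_leaf (de_sitter c) D N L) \<and> (\<exists>L\<in>F. complete_leaf L))"
proof
  assume "(\<forall>L\<in>F. totally_geodesic_leaf (de_sitter c) D N L) \<and> (\<exists>L\<in>F. complete_leaf L)"
  then have geod: "\<And>L. L \<in> F \<Longrightarrow> totally_geodesic_leaf (de_sitter c) D N L" by blast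
  let ?M = "de_sitter c :: 'n lorentz_space set"
  let ?dN = "\<lambda>x. frechet_derivative N (at x within ?M)"
  note c = \<open>c > 0\<close> and D = assms(2) and NF = assms(4)
  have F: "foliation_on ?M F" using assms(3) by (simp add: spacelike_foliation_on_def)
  have N: "N \<in> vector_fields ?M" using NF by (simp add: unit_timelike_normal_field_def)
  note NN = unit_normal_facts(2,3)[OF NF]
  have cont: "continuous_on ?M (\<lambda>x. ?dN x (N x))"
  proof -
    have "D N N \<in> vector_fields ?M" by (rule levi_civita_closed[OF D N N])
    then have "continuous_on ?M (D N N)"
      by (simp add: vector_fields_def smooth_on_continuous_on)
    then have "continuous_on ?M (\<lambda>x. D N N x + (1 / c) *\<^sub>R x)"
      by (intro continuous_intros)
    then show ?thesis
      using normal_derivative_along_normal[OF c D F NF] by (simp cong: continuous_on_cong)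
  qed
  have sphere: "N y = N q" if q: "q \<in> ?M" and y: "y \<in> ?M" "lorentz y (N q) = 0" for q y
  proof -
    have "lorentz q (N q) = 0" using NN(2)[OF q] by (simp add: lorentz_commute)
    then obtain b e where be: "0 \<le> b" "e \<in> horizontal q (N q)" "lorentz e e = c"
      "y = cos b *\<^sub>R q + sin b *\<^sub>R e"
      using great_sphere_covered_by_great_circles[OF c q _ NN(1)[OF q] y] by metis
    show ?thesis
      unfolding be(4)
      by (rule normal_constant_on_great_circle[OF vector_field_has_derivative[OF N] NN
            normal_derivative_zero[OF c D F NF geod] cont q be(2,3,1)])
  qed
  define q :: "'n lorentz_space" where "q = ((0, sqrt c), 0)"
  have q: "q \<in> ?M" using c by (simp add: q_def de_sitter_def lorentz_eq)
  \<comment> \<open>A second point whose position vector is not orthogonal to \<open>N q\<close>; the hyperbolic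
    coefficients satisfy \<open>2 c - c = c\<close>, which keeps \<open>q'\<close> on the hyperquadric.\<close>
  define q' where "q' = sqrt 2 *\<^sub>R q + sqrt c *\<^sub>R N q"
  have q': "q' \<in> ?M"
    using q c NN[OF q]
    by (simp add: q'_def de_sitter_def lorentz_simps lorentz_commute[of q "N q"])
  obtain v where v: "v \<noteq> 0" "lorentz v (N q) = 0" "lorentz v (N q') = 0"
    by (rule exists_lorentz_orthogonal_to_two)
  \<comment> \<open>A point where the great spheres orthogonal to \<open>N q\<close> and to \<open>N q'\<close> meet.\<close>
  define x where "x = sqrt (c / lorentz v v) *\<^sub>R v"
  have "x \<in> ?M"
    unfolding x_def de_sitter_def
    using lorentz_normalize[OF c lorentz_pos_on_timelike_complement[OF NN(1)[OF q] v(2,1)]] by simp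
  moreover have "lorentz x (N q) = 0" "lorentz x (N q') = 0"
    using v by (simp_all add: x_def lorentz_simps)
  ultimately have "N q = N q'" using sphere[OF q] sphere[OF q'] by metis
  then have "lorentz (N q) q' = 0" using NN(2)[OF q'] by simp
  moreover have "lorentz (N q) q' = - sqrt c"
    using NN[OF q] by (simp add: q'_def lorentz_simps)
  ultimately show False using c by simp
qed

end
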